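(* For a ring $R$, the following four conditions are equivalent: (1) $R$ is a clean $W\Delta U$ ring. (2) For each $a\in R$, we have ($a-a^2\in\Delta(R)$ or $a+a^2\in\Delta(R)$), and there is an idempotent $e\in R$ such that ($a-e\in\Delta(R)$ or $a+e\in\Delta(R)$). (3) $R$ is a weakly $\Delta$-clean $W\Delta U$ ring. (4) $R$ is a weakly $\Delta$-clean ring.
   Context: Rings are associative with identity, not necessarily commutative. $U(R)$ is the group of units of $R$. $\Delta(R)=\{r\in R : r+u\in U(R)\text{ for all }u\in U(R)\}$; equivalently $\Delta(R)=J(T)$, where $T$ is the subring of $R$ generated by $U(R)$ and $J$ denotes the Jacobson radical. $R$ is $W\Delta U$ if $U(R)=\pm 1+\Delta(R)$, i.e. every unit of $R$ has the form $1+d$ or $-1+d$ with $d\in\Delta(R)$. $R$ is clean if every element is the sum of an idempotent and a unit. $R$ is weakly $\Delta$-clean if every $r\in R$ can be written as $r=d+e$ or $r=d-e$ with $d\in\Delta(R)$ and $e^2=e\in R$. *)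

theory Defs
  imports "HOL-Algebra.Ring"
begin

text \<open>The locale \<^locale>\<open>ring\<close> is that of associative unital rings, not necessarily
  commutative, with the zero ring included; \<^const>\<open>Units\<close> consists of the two-sided units.\<close>

definition idempotents :: "('a, 'b) ring_scheme \<Rightarrow> 'a set"
  where "idempotents R = {e \<in> carrier R. e \<otimes>\<^bsub>R\<^esub> e = e}"

definition Delta :: "('a, 'b) ring_scheme \<Rightarrow> 'a set"
  where "Delta R = {r \<in> carrier R. \<forall>u \<in> Units R. r \<oplus>\<^bsub>R\<^esub> u \<in> Units R}"

definition WDeltaU :: "('a, 'b) ring_scheme \<Rightarrow> bool"
  where "WDeltaU R \<longleftrightarrow>
    Units R = {\<one>\<^bsub>R\<^esub> \<oplus>\<^bsub>R\<^esub> d | d. d \<in> Delta R} \<union> {\<ominus>\<^bsub>R\<^esub> \<one>\<^bsub>R\<^esub> \<oplus>\<^bsub>R\<^esub> d | d. d \<in> Delta R}"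

definition clean :: "('a, 'b) ring_scheme \<Rightarrow> bool"
  where "clean R \<longleftrightarrow>
    (\<forall>r \<in> carrier R. \<exists>e \<in> idempotents R. \<exists>u \<in> Units R. r = e \<oplus>\<^bsub>R\<^esub> u)"

definition weakly_Delta_clean :: "('a, 'b) ring_scheme \<Rightarrow> bool"
  where "weakly_Delta_clean R \<longleftrightarrow>
    (\<forall>r \<in> carrier R. \<exists>d \<in> Delta R. \<exists>e \<in> idempotents R.
        r = d \<oplus>\<^bsub>R\<^esub> e \<or> r = d \<ominus>\<^bsub>R\<^esub> e)"

end

theory Submission imports Defs
begin

text \<open>\<open>\<Delta>\<close> is an additive subgroup that absorbs multiplication by units. If every unit is
  \<open>\<plusminus>1\<close> modulo \<open>\<Delta>\<close>, then elements of square zero lie in \<open>\<Delta>\<close>; hence \<open>ed + de \<in> \<Delta>\<close> for \<open>d \<in> \<Delta>\<close>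
  and \<open>e\<close> idempotent, which makes \<open>d + e\<close> idempotent modulo \<open>\<Delta>\<close>. For a clean \<open>W\<Delta>U\<close> ring
  the only bad decomposition is \<open>r = e + 1\<close> modulo \<open>\<Delta>\<close>. Since \<open>2e - 1\<close> is a unit, \<open>2e \<in> \<Delta>\<close>,
  whence \<open>r = 1 - e\<close>, or \<open>2(1 - e) \<in> \<Delta>\<close>. In the latter case decompose \<open>2 + e = f \<plusminus> 1\<close>: the sign \<open>+\<close>
  gives \<open>r = f\<close>, while \<open>3 + e = f\<close> being idempotent modulo \<open>\<Delta>\<close> forces \<open>12 \<in> \<Delta>\<close>, then \<open>6 \<in> \<Delta>\<close>, and
  \<open>r = -f\<close>.\<close>

context ring
begin

text \<open>The method \<open>algebra\<close> for noncommutative rings does not use \<open>r_one\<close> by default.\<close>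

declare r_one [algebra ring "zero R" "add R" "a_inv R" "a_minus R" "one R" "mult R"]

section \<open>Closure properties of \<Delta>\<close>

lemma DeltaI:
  "r \<in> carrier R \<Longrightarrow> (\<And>u. u \<in> Units R \<Longrightarrow> r \<oplus> u \<in> Units R) \<Longrightarrow> r \<in> Delta R"
  by (simp add: Delta_def)

lemma Delta_plus_unit: "d \<in> Delta R \<Longrightarrow> u \<in> Units R \<Longrightarrow> d \<oplus> u \<in> Units R"
  by (simp add: Delta_def)

lemma Delta_carrier [simp]: "d \<in> Delta R \<Longrightarrow> d \<in> carrier R"
  by (simp add: Delta_def)

lemma unit_plus_Delta: "d \<in> Delta R \<Longrightarrow> u \<in> Units R \<Longrightarrow> u \<oplus> d \<in> Units R"
  by (metis Delta_plus_unit Delta_carrier Units_closed a_comm)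

lemma minus_unit: "u \<in> Units R \<Longrightarrow> \<ominus> u \<in> Units R"
  unfolding Units_def by clarify (metis a_inv_closed l_minus r_minus minus_minus)

lemma Delta_zero [simp]: "\<zero> \<in> Delta R"
  by (rule DeltaI) (simp_all add: Units_closed)

lemma Delta_add [simp]:
  assumes "x \<in> Delta R" "y \<in> Delta R" shows "x \<oplus> y \<in> Delta R"
  using assms by (intro DeltaI) (simp_all add: Delta_plus_unit a_assoc Units_closed)

lemma Delta_minus [simp]:
  assumes "x \<in> Delta R" shows "\<ominus> x \<in> Delta R"
proof -
  have "\<ominus> x \<oplus> u \<in> Units R" if u: "u \<in> Units R" for u
  proof -
    have "\<ominus> x \<oplus> u = \<ominus> (x \<oplus> \<ominus> u)"
      using assms u by (simp add: minus_add Units_closed)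
    then show ?thesis
      using minus_unit Delta_plus_unit assms u by presburger
  qed
  then show ?thesis using assms by (intro DeltaI) (simp_all add: Units_closed)
qed

lemma Delta_diff [simp]:
  assumes "x \<in> Delta R" "y \<in> Delta R" shows "x \<ominus> y \<in> Delta R"
  using assms by (simp add: minus_eq)

lemma Delta_diff_cancel:
  assumes "x \<ominus> y \<in> Delta R" "x \<in> Delta R" "y \<in> carrier R" shows "y \<in> Delta R"
proof -
  have "x \<ominus> (x \<ominus> y) = y" using assms(2)[THEN Delta_carrier] assms(3) by algebra
  then show ?thesis using assms Delta_diff by metis
qed

text \<open>Pulling out \<open>u\<close> leaves \<open>x\<close> plus the unit
  \<open>inv u \<otimes> v\<close>, to which membership of \<open>x\<close> in \<Delta>
  applies.\<close>

lemma Delta_unit_l: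
  assumes "u \<in> Units R" "x \<in> Delta R" shows "u \<otimes> x \<in> Delta R"
proof -
  have "u \<otimes> x \<oplus> v \<in> Units R" if v: "v \<in> Units R" for v
  proof -
    have "u \<otimes> x \<oplus> v = u \<otimes> (x \<oplus> inv u \<otimes> v)"
      using assms v by (simp add: r_distr Units_closed m_assoc[symmetric])
    then show ?thesis using assms v by (simp add: Delta_plus_unit)
  qed
  then show ?thesis using assms by (intro DeltaI) (simp_all add: Units_closed)
qed

lemma Delta_unit_r:
  assumes "u \<in> Units R" "x \<in> Delta R" shows "x \<otimes> u \<in> Delta R"
proof -
  have "x \<otimes> u \<oplus> v \<in> Units R" if v: "v \<in> Units R" for v
  proof -
    have "x \<otimes> u \<oplus> v = (x \<oplus> v \<otimes> inv u) \<otimes> u"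
      using assms v by (simp add: l_distr Units_closed m_assoc)
    then show ?thesis using assms v by (simp add: Delta_plus_unit)
  qed
  then show ?thesis using assms by (intro DeltaI) (simp_all add: Units_closed)
qed

text \<open>Since \<open>\<one> \<oplus> y\<close> is a unit, this reduces to absorption of
  units.\<close>

lemma Delta_mult:
  assumes "x \<in> Delta R" "y \<in> Delta R" shows "x \<otimes> y \<in> Delta R"
proof -
  have "x \<otimes> (\<one> \<oplus> y) \<ominus> x \<in> Delta R"
    using assms by (simp add: Delta_unit_r unit_plus_Delta)
  moreover have "x \<otimes> (\<one> \<oplus> y) \<ominus> x = x \<otimes> y"
    using assms[THEN Delta_carrier] by algebra
  ultimately show ?thesis by simp
qed

section \<open>Central elements whose square lies in \<Delta>\<close>

lemma unit_of_commuting_product: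
  assumes xy: "x \<in> carrier R" "y \<in> carrier R"
    and comm: "x \<otimes> y = y \<otimes> x" and u: "x \<otimes> y \<in> Units R"
  shows "x \<in> Units R"
proof -
  define w where "w = inv (x \<otimes> y)"
  have w: "w \<in> carrier R" using u by (simp add: w_def)
  have r: "x \<otimes> (y \<otimes> w) = \<one>"
    using u xy w by (simp add: m_assoc[symmetric] w_def)
  have l: "(w \<otimes> y) \<otimes> x = \<one>"
    using u xy w by (simp add: m_assoc comm[symmetric]) (simp add: w_def)
  have "w \<otimes> y = y \<otimes> w"
    using inv_unique[OF l r] xy w by simp
  then show ?thesis
    using l r xy w by (auto simp: Units_def)
qed

text \<open>The commuting factors c + u and u - c have product u^2 - c^2, a unit perturbed by
  \<Delta>. This is used for the integers 2 and 6.\<close>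

lemma central_square_Delta:
  assumes c: "c \<in> carrier R" and central: "\<And>u. u \<in> Units R \<Longrightarrow> c \<otimes> u = u \<otimes> c"
    and sq: "c \<otimes> c \<in> Delta R"
  shows "c \<in> Delta R"
proof -
  have "c \<oplus> u \<in> Units R" if u: "u \<in> Units R" for u
  proof (rule unit_of_commuting_product)
    have uc: "u \<in> carrier R" using u by (rule Units_closed)
    show "c \<oplus> u \<in> carrier R" "u \<ominus> c \<in> carrier R" using c uc by auto
    \<comment> \<open>The commutator is kept as a separate summand, to vanish once
      \<open>central\<close> is applied.\<close>
    have eq: "(c \<oplus> u) \<otimes> (u \<ominus> c) = (c \<otimes> u \<ominus> u \<otimes> c) \<oplus> (\<ominus> (c \<otimes> c) \<oplus> u \<otimes> u)"
      using c uc by algebra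
    have eq': "(u \<ominus> c) \<otimes> (c \<oplus> u) = (u \<otimes> c \<ominus> c \<otimes> u) \<oplus> (\<ominus> (c \<otimes> c) \<oplus> u \<otimes> u)"
      using c uc by algebra
    show "(c \<oplus> u) \<otimes> (u \<ominus> c) = (u \<ominus> c) \<otimes> (c \<oplus> u)"
      unfolding eq eq' central[OF u] by simp
    have "\<ominus> (c \<otimes> c) \<oplus> u \<otimes> u \<in> Units R"
      using sq u by (intro Delta_plus_unit) auto
    then show "(c \<oplus> u) \<otimes> (u \<ominus> c) \<in> Units R"
      unfolding eq central[OF u] using c uc by (simp add: minus_eq r_neg Units_closed)
  qed
  then show ?thesis using c by (intro DeltaI) (simp_all add: Units_closed)
qed

section \<open>Idempotents and units\<close>

lemma idempotent_square: "e \<in> idempotents R \<Longrightarrow> e \<otimes> e = e"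
  by (simp add: idempotents_def)

lemma idempotentI: "e \<in> carrier R \<Longrightarrow> e \<otimes> e = e \<Longrightarrow> e \<in> idempotents R"
  by (simp add: idempotents_def)

lemma idempotent_carrier [simp]: "e \<in> idempotents R \<Longrightarrow> e \<in> carrier R"
  by (simp add: idempotents_def)

lemma idempotent_complement:
  assumes "e \<in> idempotents R" shows "\<one> \<ominus> e \<in> idempotents R"
proof -
  have "(\<one> \<ominus> e) \<otimes> (\<one> \<ominus> e) = \<one> \<ominus> e \<ominus> e \<oplus> e \<otimes> e"
    using assms[THEN idempotent_carrier] by algebra
  also have "\<dots> = \<one> \<ominus> e \<ominus> e \<oplus> e" by (simp add: idempotent_square[OF assms])
  also have "\<dots> = \<one> \<ominus> e"
    using assms[THEN idempotent_carrier] by algebra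
  finally show ?thesis using assms by (simp add: idempotentI)
qed

lemma idempotent_unit_one:
  assumes "e \<in> idempotents R" "e \<in> Units R" shows "e = \<one>"
  using assms by (metis Units_l_cancel Units_closed idempotent_square one_closed r_one)

text \<open>The element 2e - 1 is its own inverse.\<close>

lemma unit_of_idempotent:
  assumes "e \<in> idempotents R" shows "e \<oplus> e \<ominus> \<one> \<in> Units R"
proof -
  have ec: "e \<in> carrier R" using assms by simp
  have "(e \<oplus> e \<ominus> \<one>) \<otimes> (e \<oplus> e \<ominus> \<one>)
      = (e \<otimes> e \<oplus> e \<otimes> e) \<oplus> (e \<otimes> e \<oplus> e \<otimes> e) \<ominus> (e \<oplus> e) \<ominus> (e \<oplus> e) \<oplus> \<one>"
    using ec by algebra
  also have "\<dots> = (e \<oplus> e) \<oplus> (e \<oplus> e) \<ominus> (e \<oplus> e) \<ominus> (e \<oplus> e) \<oplus> \<one>"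
    by (simp add: idempotent_square[OF assms])
  also have "\<dots> = \<one>" using ec by algebra
  finally show ?thesis using ec by (auto simp: Units_def)
qed

section \<open>Consequences of the W\<Delta>U condition\<close>

lemma WDeltaU_unit_cases:
  assumes "WDeltaU R" "u \<in> Units R"
  shows "u \<ominus> \<one> \<in> Delta R \<or> u \<oplus> \<one> \<in> Delta R"
proof -
  from assms obtain d where d: "d \<in> Delta R" and "u = \<one> \<oplus> d \<or> u = \<ominus> \<one> \<oplus> d"
    unfolding WDeltaU_def by blast
  moreover have "\<one> \<oplus> d \<ominus> \<one> = d" "\<ominus> \<one> \<oplus> d \<oplus> \<one> = d"
    using d[THEN Delta_carrier] by algebra+
  ultimately show ?thesis by auto
qed

text \<open>The two cases are the two possible signs of the unit 2e - 1 modulo \<Delta>.\<close>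

lemma WDeltaU_two_idempotent:
  assumes "WDeltaU R" "e \<in> idempotents R"
  shows "e \<oplus> e \<in> Delta R \<or> \<one> \<oplus> \<one> \<ominus> (e \<oplus> e) \<in> Delta R"
proof -
  have ec: "e \<in> carrier R" using assms by simp
  have "e \<oplus> e \<ominus> \<one> \<oplus> \<one> = e \<oplus> e"
    "\<ominus> (e \<oplus> e \<ominus> \<one> \<ominus> \<one>) = \<one> \<oplus> \<one> \<ominus> (e \<oplus> e)"
    using ec by algebra+
  then show ?thesis
    using WDeltaU_unit_cases[OF assms(1) unit_of_idempotent[OF assms(2)]] Delta_minus
    by metis
qed

text \<open>The units 1 + n and 1 - n are mutually inverse. If 1 + n is 1 modulo \<Delta>, the claim
  is immediate; the sign -1 is handled by showing that 2 lies in \<Delta>.\<close>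

lemma WDeltaU_square_zero:
  assumes W: "WDeltaU R" and n: "n \<in> carrier R" and sq: "n \<otimes> n = \<zero>"
  shows "n \<in> Delta R"
proof -
  have "(\<one> \<oplus> n) \<otimes> (\<one> \<ominus> n) = \<one> \<ominus> n \<otimes> n" "(\<one> \<ominus> n) \<otimes> (\<one> \<oplus> n) = \<one> \<ominus> n \<otimes> n"
    using n by algebra+
  then have "(\<one> \<oplus> n) \<otimes> (\<one> \<ominus> n) = \<one>" "(\<one> \<ominus> n) \<otimes> (\<one> \<oplus> n) = \<one>"
    using sq by (simp_all add: minus_eq)
  then have unit: "\<one> \<oplus> n \<in> Units R" "\<one> \<ominus> n \<in> Units R"
    using n unfolding Units_def by auto
  from WDeltaU_unit_cases[OF W unit(1)] show ?thesis
  proof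
    assume "\<one> \<oplus> n \<ominus> \<one> \<in> Delta R"
    moreover have "\<one> \<oplus> n \<ominus> \<one> = n" using n by algebra
    ultimately show ?thesis by simp
  next
    let ?two = "\<one> \<oplus> \<one>"
    assume p: "\<one> \<oplus> n \<oplus> \<one> \<in> Delta R"
    \<comment> \<open>Multiplying 2 + n by the unit 1 - n gives 2 - n, and the sum of the two is 4,
      the square of the central element 2.\<close>
    have "(\<one> \<ominus> n) \<otimes> (\<one> \<oplus> n \<oplus> \<one>) \<in> Delta R"
      using unit(2) p by (rule Delta_unit_l)
    moreover have "(\<one> \<ominus> n) \<otimes> (\<one> \<oplus> n \<oplus> \<one>) = ?two \<ominus> n \<ominus> n \<otimes> n"
      using n by algebra
    ultimately have "?two \<ominus> n \<in> Delta R"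
      using sq n by (simp add: minus_eq)
    then have "(?two \<ominus> n) \<oplus> (\<one> \<oplus> n \<oplus> \<one>) \<in> Delta R"
      using p by simp
    moreover have "(?two \<ominus> n) \<oplus> (\<one> \<oplus> n \<oplus> \<one>) = ?two \<otimes> ?two"
      using n by algebra
    ultimately have "?two \<otimes> ?two \<in> Delta R" by simp
    then have "?two \<in> Delta R"
      by (rule central_square_Delta[rotated 2]) (auto simp: l_distr r_distr Units_closed)
    then have "(\<one> \<oplus> n \<oplus> \<one>) \<ominus> ?two \<in> Delta R" using p by simp
    moreover have "(\<one> \<oplus> n \<oplus> \<one>) \<ominus> ?two = n" using n by algebra
    ultimately show ?thesis by simp
  qed
qed

text \<open>The commutator of \<open>e\<close> and \<open>d\<close> is a difference of the two off-diagonal Peirce components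
  of \<open>d\<close>, which square to zero; and \<open>2ed\<close> lies in \<open>\<Delta>\<close> since \<open>2e - 1\<close> is a unit.\<close>

lemma WDeltaU_idempotent_anticommutator:
  assumes W: "WDeltaU R" and d: "d \<in> Delta R" and e: "e \<in> idempotents R"
  shows "e \<otimes> d \<oplus> d \<otimes> e \<in> Delta R"
proof -
  have c: "d \<in> carrier R" "e \<in> carrier R" using d e by simp_all
  let ?p = "e \<otimes> d \<ominus> e \<otimes> d \<otimes> e" and ?q = "d \<otimes> e \<ominus> e \<otimes> d \<otimes> e"
  \<comment> \<open>Both expansions keep \<open>e \<otimes> e\<close> grouped, so that idempotence
    can be substituted before cancelling.\<close>
  have pp: "?p \<otimes> ?p = e \<otimes> d \<otimes> e \<otimes> d \<ominus> e \<otimes> d \<otimes> (e \<otimes> e) \<otimes> d 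
      \<ominus> e \<otimes> d \<otimes> e \<otimes> d \<otimes> e \<oplus> e \<otimes> d \<otimes> (e \<otimes> e) \<otimes> d \<otimes> e"
    using c by algebra
  have qq: "?q \<otimes> ?q = d \<otimes> e \<otimes> d \<otimes> e \<ominus> d \<otimes> (e \<otimes> e) \<otimes> d \<otimes> e
      \<ominus> e \<otimes> d \<otimes> e \<otimes> d \<otimes> e \<oplus> e \<otimes> d \<otimes> (e \<otimes> e) \<otimes> d \<otimes> e"
    using c by algebra
  have "?p \<otimes> ?p = \<zero>" "?q \<otimes> ?q = \<zero>"
    unfolding pp qq idempotent_square[OF e] using c by algebra+
  then have pq: "?p \<in> Delta R" "?q \<in> Delta R"
    using WDeltaU_square_zero[OF W] c by simp_all
  have "(e \<oplus> e \<ominus> \<one>) \<otimes> d \<in> Delta R"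
    using unit_of_idempotent[OF e] d by (rule Delta_unit_l)
  \<comment> \<open>This is 2ed minus the commutator ed - de.\<close>
  then have "(e \<oplus> e \<ominus> \<one>) \<otimes> d \<oplus> d \<ominus> (?p \<ominus> ?q) \<in> Delta R"
    using d pq by simp
  moreover have "(e \<oplus> e \<ominus> \<one>) \<otimes> d \<oplus> d \<ominus> (?p \<ominus> ?q) = e \<otimes> d \<oplus> d \<otimes> e"
    using c by algebra
  ultimately show ?thesis by simp
qed

lemma WDeltaU_Delta_plus_idempotent:
  assumes W: "WDeltaU R" and d: "d \<in> Delta R" and e: "e \<in> idempotents R"
  shows "(d \<oplus> e) \<ominus> (d \<oplus> e) \<otimes> (d \<oplus> e) \<in> Delta R"
proof -
  have c: "d \<in> carrier R" "e \<in> carrier R" using d e by simp_all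
  have "(d \<oplus> e) \<ominus> (d \<oplus> e) \<otimes> (d \<oplus> e) =
      d \<ominus> d \<otimes> d \<ominus> (e \<otimes> d \<oplus> d \<otimes> e) \<oplus> (e \<ominus> e \<otimes> e)"
    using c by algebra
  also have "\<dots> = d \<ominus> d \<otimes> d \<ominus> (e \<otimes> d \<oplus> d \<otimes> e)"
    using c by (simp add: idempotent_square[OF e] minus_eq r_neg)
  also have "\<dots> \<in> Delta R"
    using WDeltaU_idempotent_anticommutator[OF W d e] d Delta_mult[OF d d] by simp
  finally show ?thesis .
qed

section \<open>Weakly \<Delta>-clean rings\<close>

lemma weakly_Delta_clean_alt:
  "weakly_Delta_clean R \<longleftrightarrow>
    (\<forall>a \<in> carrier R. \<exists>e \<in> idempotents R. a \<ominus> e \<in> Delta R \<or> a \<oplus> e \<in> Delta R)"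
proof -
  have "(\<exists>d \<in> Delta R. a = d \<oplus> e) \<longleftrightarrow> a \<ominus> e \<in> Delta R"
    "(\<exists>d \<in> Delta R. a = d \<ominus> e) \<longleftrightarrow> a \<oplus> e \<in> Delta R"
    if c: "a \<in> carrier R" "e \<in> idempotents R" for a e
  proof -
    have "d \<oplus> e \<ominus> e = d" "d \<ominus> e \<oplus> e = d" if "d \<in> carrier R" for d
      using that c(2)[THEN idempotent_carrier] by algebra+
    moreover from this have "a = (a \<ominus> e) \<oplus> e" "a = (a \<oplus> e) \<ominus> e"
      using c(1) c(2)[THEN idempotent_carrier] by algebra+
    ultimately show "(\<exists>d \<in> Delta R. a = d \<oplus> e) \<longleftrightarrow> a \<ominus> e \<in> Delta R"
      "(\<exists>d \<in> Delta R. a = d \<ominus> e) \<longleftrightarrow> a \<oplus> e \<in> Delta R"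
      using Delta_carrier by metis+
  qed
  then show ?thesis unfolding weakly_Delta_clean_def by blast
qed

text \<open>If a unit is d + e or d - e, subtracting d shows that e is a unit, hence e = 1.\<close>

lemma weakly_Delta_clean_imp_WDeltaU:
  assumes "weakly_Delta_clean R" shows "WDeltaU R"
proof -
  have "\<exists>d \<in> Delta R. u = \<one> \<oplus> d \<or> u = \<ominus> \<one> \<oplus> d" if u: "u \<in> Units R" for u
  proof -
    have uc: "u \<in> carrier R" using u by (rule Units_closed)
    from assms uc obtain d e where d: "d \<in> Delta R" and e: "e \<in> idempotents R"
      and de: "u = d \<oplus> e \<or> u = d \<ominus> e" unfolding weakly_Delta_clean_def by blast
    have c: "d \<in> carrier R" "e \<in> carrier R" using d e by simp_all
    have "e = \<ominus> d \<oplus> (d \<oplus> e)" "e = d \<oplus> \<ominus> (d \<ominus> e)" using c by algebra+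
    then have "e \<in> Units R"
      using de u d by (metis Delta_plus_unit Delta_minus minus_unit)
    then have "e = \<one>" using e by (simp add: idempotent_unit_one)
    then show ?thesis using de d c a_comm by (auto simp: minus_eq)
  qed
  \<comment> \<open>The other inclusion, that elements of \<plusminus>1 + \<Delta> are units, holds
    in every ring.\<close>
  then show ?thesis
    unfolding WDeltaU_def by (auto simp: unit_plus_Delta minus_unit)
qed

text \<open>Both signs use the idempotent 1 - e; what remains is d plus the unit 2e - 1, or d plus
  -1.\<close>

lemma weakly_Delta_clean_imp_clean:
  assumes "weakly_Delta_clean R" shows "clean R"
  unfolding clean_def
proof
  fix r assume "r \<in> carrier R"
  with assms obtain d e where d: "d \<in> Delta R" and e: "e \<in> idempotents R"
    and de: "r = d \<oplus> e \<or> r = d \<ominus> e" unfolding weakly_Delta_clean_def by blast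
  have c: "d \<in> carrier R" "e \<in> carrier R" using d e by simp_all
  have "d \<oplus> e = (\<one> \<ominus> e) \<oplus> (d \<oplus> (e \<oplus> e \<ominus> \<one>))"
    "d \<ominus> e = (\<one> \<ominus> e) \<oplus> (d \<oplus> \<ominus> \<one>)"
    using c by algebra+
  moreover have "d \<oplus> (e \<oplus> e \<ominus> \<one>) \<in> Units R" "d \<oplus> \<ominus> \<one> \<in> Units R"
    using d unit_of_idempotent[OF e] by (simp_all add: Delta_plus_unit minus_unit)
  ultimately show "\<exists>e \<in> idempotents R. \<exists>u \<in> Units R. r = e \<oplus> u"
    using de idempotent_complement[OF e] by metis
qed

lemma weakly_Delta_clean_quadratic:
  assumes "weakly_Delta_clean R" "a \<in> carrier R"
  shows "a \<ominus> a \<otimes> a \<in> Delta R \<or> a \<oplus> a \<otimes> a \<in> Delta R"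
proof -
  have W: "WDeltaU R" using assms(1) by (rule weakly_Delta_clean_imp_WDeltaU)
  from assms obtain d e where d: "d \<in> Delta R" and e: "e \<in> idempotents R"
    and "a = d \<oplus> e \<or> a = d \<ominus> e" unfolding weakly_Delta_clean_def by blast
  then show ?thesis
  proof (elim disjE)
    assume "a = d \<oplus> e"
    then show ?thesis using WDeltaU_Delta_plus_idempotent[OF W d e] by simp
  next
    assume a: "a = d \<ominus> e"
    have c: "d \<in> carrier R" "e \<in> carrier R" using d e by simp_all
    \<comment> \<open>Passing to \<open>?b\<close>, which is -a, reduces the minus sign to the plus
      sign.\<close>
    let ?b = "\<ominus> d \<oplus> e"
    have "a \<oplus> a \<otimes> a = \<ominus> (?b \<ominus> ?b \<otimes> ?b)"
      unfolding a using c by algebra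
    then show ?thesis using WDeltaU_Delta_plus_idempotent[OF W _ e, of "\<ominus> d"] d by simp
  qed
qed

section \<open>From clean W\<Delta>U to weakly \<Delta>-clean\<close>

lemma WDeltaU_clean_cases:
  assumes "clean R" "WDeltaU R" "r \<in> carrier R"
  obtains e where "e \<in> idempotents R" "r \<ominus> e \<ominus> \<one> \<in> Delta R"
  | e where "e \<in> idempotents R" "r \<ominus> e \<oplus> \<one> \<in> Delta R"
proof -
  from assms obtain e u where e: "e \<in> idempotents R" and u: "u \<in> Units R" and r: "r = e \<oplus> u"
    unfolding clean_def by blast
  have "r \<ominus> e = u"
    unfolding r using e[THEN idempotent_carrier] u[THEN Units_closed] by algebra
  then show thesis
    using WDeltaU_unit_cases[OF assms(2) u] that e by blast
qed

lemma clean_WDeltaU_imp_weakly_Delta_clean: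
  assumes C: "clean R" and W: "WDeltaU R" shows "weakly_Delta_clean R"
  unfolding weakly_Delta_clean_alt
proof
  fix r assume r: "r \<in> carrier R"
  let ?thesis = "\<exists>e \<in> idempotents R. r \<ominus> e \<in> Delta R \<or> r \<oplus> e \<in> Delta R"
  from C W r show ?thesis
  proof (cases rule: WDeltaU_clean_cases)
    fix e assume e: "e \<in> idempotents R" and D: "r \<ominus> e \<oplus> \<one> \<in> Delta R"
    have "r \<ominus> e \<oplus> \<one> = r \<oplus> (\<one> \<ominus> e)" 
      using r e[THEN idempotent_carrier] by algebra
    then show ?thesis using D idempotent_complement[OF e] by auto
  next
    \<comment> \<open>The bad sign: r is e + 1 modulo \<Delta>.\<close>
    fix e assume e: "e \<in> idempotents R" and D: "r \<ominus> e \<ominus> \<one> \<in> Delta R"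
    have ec: "e \<in> carrier R" using e by simp
    from WDeltaU_two_idempotent[OF W e] show ?thesis
    proof
      assume "e \<oplus> e \<in> Delta R"
      then have "(r \<ominus> e \<ominus> \<one>) \<oplus> (e \<oplus> e) \<in> Delta R" using D by simp
      moreover have "(r \<ominus> e \<ominus> \<one>) \<oplus> (e \<oplus> e) = r \<ominus> (\<one> \<ominus> e)"
        using r ec by algebra
      ultimately show ?thesis using idempotent_complement[OF e] by auto
    next
      let ?t = "\<one> \<oplus> \<one> \<ominus> (e \<oplus> e)"
      assume t: "?t \<in> Delta R"
      \<comment> \<open>Modulo \<Delta>, 2 + e is r + 1, so a decomposition f + 1 of it makes r
        congruent to f.\<close>
      have "\<one> \<oplus> \<one> \<oplus> e \<in> carrier R" using ec by simp
      with C W show ?thesis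
      proof (cases rule: WDeltaU_clean_cases)
        fix f assume f: "f \<in> idempotents R" and F: "\<one> \<oplus> \<one> \<oplus> e \<ominus> f \<ominus> \<one> \<in> Delta R"
        have "(r \<ominus> e \<ominus> \<one>) \<oplus> (\<one> \<oplus> \<one> \<oplus> e \<ominus> f \<ominus> \<one>) \<in> Delta R" using D F by simp
        moreover have "(r \<ominus> e \<ominus> \<one>) \<oplus> (\<one> \<oplus> \<one> \<oplus> e \<ominus> f \<ominus> \<one>) = r \<ominus> f"
          using r ec f[THEN idempotent_carrier] by algebra
        ultimately show ?thesis using f by auto
      next
        fix f assume f: "f \<in> idempotents R" and F: "\<one> \<oplus> \<one> \<oplus> e \<ominus> f \<oplus> \<one> \<in> Delta R"
        have fc: "f \<in> carrier R" using f by simp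
        \<comment> \<open>Here \<open>s\<close> is 3, and \<open>g\<close> is the element of
          \<open>F\<close>, so that 3 + e = g + f is idempotent modulo \<Delta>.\<close>
        define s where "s = \<one> \<oplus> \<one> \<oplus> \<one>"
        define g where "g = s \<oplus> e \<ominus> f"
        have s: "s \<in> carrier R" by (simp add: s_def)
        have "\<one> \<oplus> \<one> \<oplus> e \<ominus> f \<oplus> \<one> = g"
          unfolding g_def s_def using ec fc by algebra
        with F have g: "g \<in> Delta R" by simp
        have ts: "?t = s \<ominus> \<one> \<ominus> (e \<oplus> e)"
          unfolding s_def using ec by algebra
        have s_mult: "s \<otimes> x = x \<oplus> x \<oplus> x" "x \<otimes> s = x \<oplus> x \<oplus> x" if "x \<in> carrier R" for x
          unfolding s_def using that by algebra+
        have "g \<oplus> f = s \<oplus> e" unfolding g_def using s ec fc by algebra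
        then have "(s \<oplus> e) \<ominus> (s \<oplus> e) \<otimes> (s \<oplus> e) \<in> Delta R"
          using WDeltaU_Delta_plus_idempotent[OF W g f] by simp
        moreover have "(s \<oplus> e) \<ominus> (s \<oplus> e) \<otimes> (s \<oplus> e) = s \<oplus> e \<ominus> (s \<otimes> s \<oplus> s \<otimes> e \<oplus> e \<otimes> s \<oplus> e \<otimes> e)"
          using s ec by algebra
        \<comment> \<open>Both sides are -6 - 6e: the right one is 3(2 - 2e) - 12. As
          \<open>?t\<close> lies in \<Delta>, so does 12.\<close>
        moreover have "\<dots> = s \<otimes> ?t \<ominus> (s \<oplus> s \<oplus> s \<oplus> s)"
          unfolding s_mult(1)[OF s] s_mult(1)[OF ec] s_mult(2)[OF ec] idempotent_square[OF e] ts
          using s ec by (simp only: r_distr minus_eq r_minus a_inv_closed one_closed r_one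
            a_closed s_mult(1)[OF s] s_mult(1)[OF ec]) algebra
        ultimately have "s \<otimes> ?t \<ominus> (s \<oplus> s \<oplus> s \<oplus> s) \<in> Delta R" by simp
        moreover have "s \<otimes> ?t \<in> Delta R"
          using t by (simp add: s_mult(1))
        ultimately have "s \<oplus> s \<oplus> s \<oplus> s \<in> Delta R"
          using s by (blast intro: Delta_diff_cancel a_closed)
        \<comment> \<open>From 12 in \<Delta> follows 36 in \<Delta>, the square of the central
          element 6.\<close>
        then have "s \<otimes> (s \<oplus> s \<oplus> s \<oplus> s) \<in> Delta R"
          by (simp add: s_mult(1) s)
        moreover have "(s \<oplus> s) \<otimes> (s \<oplus> s) = s \<otimes> (s \<oplus> s \<oplus> s \<oplus> s)"
          using s by algebra
        ultimately have "(s \<oplus> s) \<otimes> (s \<oplus> s) \<in> Delta R" by (simp only:)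
        moreover have "(s \<oplus> s) \<otimes> u = u \<otimes> (s \<oplus> s)" if "u \<in> Units R" for u
          using s Units_closed[OF that] by (simp only: l_distr r_distr s_mult)
        ultimately have "s \<oplus> s \<in> Delta R"
          by (rule central_square_Delta[OF a_closed[OF s s], rotated])
        \<comment> \<open>In this combination the multiples of e cancel, and the constants -1 - 3 -
          2 + 6 sum to 0.\<close>
        then have "(r \<ominus> e \<ominus> \<one>) \<ominus> g \<ominus> ?t \<oplus> (s \<oplus> s) \<in> Delta R"
          using D g t by (blast intro: Delta_diff Delta_add)
        moreover have "(r \<ominus> e \<ominus> \<one>) \<ominus> g \<ominus> ?t \<oplus> (s \<oplus> s) = r \<oplus> f"
          unfolding g_def ts using r s ec fc by algebra
        ultimately show ?thesis using f by auto
      qed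
    qed
  qed
qed

end

theorem theorem3p5:
  fixes R :: "('a, 'b) ring_scheme" (structure)
  assumes "ring R"
  shows "(clean R \<and> WDeltaU R \<longleftrightarrow>
          (\<forall>a \<in> carrier R.
            (a \<ominus> a \<otimes> a \<in> Delta R \<or> a \<oplus> a \<otimes> a \<in> Delta R) \<and>
            (\<exists>e \<in> idempotents R. a \<ominus> e \<in> Delta R \<or> a \<oplus> e \<in> Delta R)))
       \<and> ((\<forall>a \<in> carrier R.
            (a \<ominus> a \<otimes> a \<in> Delta R \<or> a \<oplus> a \<otimes> a \<in> Delta R) \<and>
            (\<exists>e \<in> idempotents R. a \<ominus> e \<in> Delta R \<or> a \<oplus> e \<in> Delta R)) \<longleftrightarrow>
          weakly_Delta_clean R \<and> WDeltaU R)
       \<and> (weakly_Delta_clean R \<and> WDeltaU R \<longleftrightarrow>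
          weakly_Delta_clean R)"
proof -
  interpret ring R by fact
  \<comment> \<open>The idempotent clause is weak \<Delta>-cleanness by
    \<open>weakly_Delta_clean_alt\<close>; the quadratic clause follows from it.\<close>
  have "(\<forall>a \<in> carrier R.
            (a \<ominus> a \<otimes> a \<in> Delta R \<or> a \<oplus> a \<otimes> a \<in> Delta R) \<and>
            (\<exists>e \<in> idempotents R. a \<ominus> e \<in> Delta R \<or> a \<oplus> e \<in> Delta R))
      \<longleftrightarrow> weakly_Delta_clean R"
    using weakly_Delta_clean_alt weakly_Delta_clean_quadratic by blast
  then show ?thesis
    using weakly_Delta_clean_imp_WDeltaU weakly_Delta_clean_imp_clean
      clean_WDeltaU_imp_weakly_Delta_clean
    by argo
qed

end
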